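(* Let $(F,\le)$ be an ordered field and let $m,n$ be positive integers. For every $A\in M_{m,n}(F)$ the following hold. (1) $A$ is bounded if and only if all entries of $A$ are bounded. (2) $A$ is bibounded if and only if $A$ is bounded, $m\ge n$, and at least one of the $n\times n$ minors of $A$ is bibounded. Moreover, a square matrix $A$ over $F$ is bibounded if and only if it is invertible and both $A$ and $A^{-1}$ are bounded.
   Context: Let $M_{m,n}(F)$ be the set of $m\times n$ matrices over $F$ and $M_{\ast,n}(F)=\bigcup_{m\ge 1}M_{m,n}(F)$. A symmetric matrix $S\in M_n(F)$ is positive semidefinite if $v^TSv\ge 0$ for all $v\in F^n$; for symmetric $S,T\in M_n(F)$ write $S\le_n T$ iff $T-S$ is positive semidefinite. For $A,B\in M_{\ast,n}(F)$ write $A\succeq_n B$ iff there is $r\in\mathbb N$ such that $A^TA\le_n rB^TB$, and $A\sim_n B$ iff $A\succeq_n B$ and $B\succeq_n A$. A matrix $A\in M_{m,n}(F)$ is called bounded if $A\succeq_n I_n$ and bibounded if $A\sim_n I_n$. Scalars are regarded as $1\times1$ matrices: $a\in F$ is bounded iff $|a|\le r$ for some $r\in\mathbb N$, and bibounded iff $a\neq 0$ and both $a$ and $a^{-1}$ are bounded. *)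

theory Defs
  imports
    "Jordan_Normal_Form.Determinant"
    "Jordan_Normal_Form.Gauss_Jordan_Elimination"
    "Jordan_Normal_Form.DL_Submatrix"
begin

definition mats :: "nat \<Rightarrow> 'a mat set" where
  "mats n = (\<Union>m\<in>{1..}. carrier_mat m n)"

definition sym_mats :: "nat \<Rightarrow> 'a mat set" where
  "sym_mats n = {S \<in> carrier_mat n n. transpose_mat S = S}"

definition psd_mat :: "nat \<Rightarrow> 'a::linordered_field mat \<Rightarrow> bool" where
  "psd_mat n S \<longleftrightarrow> S \<in> sym_mats n \<and> (\<forall>v\<in>carrier_vec n. 0 \<le> v \<bullet> (S *\<^sub>v v))"

definition psd_le :: "nat \<Rightarrow> 'a::linordered_field mat \<Rightarrow> 'a mat \<Rightarrow> bool" where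
  "psd_le n S T \<longleftrightarrow> S \<in> sym_mats n \<and> T \<in> sym_mats n \<and> psd_mat n (T - S)"

(* The relation written A \<succeq>_n B. Note its orientation: A is the matrix that is
   bounded in terms of B. *)
definition mat_succeq :: "nat \<Rightarrow> 'a::linordered_field mat \<Rightarrow> 'a mat \<Rightarrow> bool" where
  "mat_succeq n A B \<longleftrightarrow> A \<in> mats n \<and> B \<in> mats n \<and>
     (\<exists>r::nat. psd_le n (transpose_mat A * A) (of_nat r \<cdot>\<^sub>m (transpose_mat B * B)))"

definition mat_sim :: "nat \<Rightarrow> 'a::linordered_field mat \<Rightarrow> 'a mat \<Rightarrow> bool" where
  "mat_sim n A B \<longleftrightarrow> mat_succeq n A B \<and> mat_succeq n B A"

definition bounded_mat :: "'a::linordered_field mat \<Rightarrow> bool" where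
  "bounded_mat A \<longleftrightarrow> mat_succeq (dim_col A) A (1\<^sub>m (dim_col A))"

definition bibounded_mat :: "'a::linordered_field mat \<Rightarrow> bool" where
  "bibounded_mat A \<longleftrightarrow> mat_sim (dim_col A) A (1\<^sub>m (dim_col A))"

definition scalar_mat :: "'a \<Rightarrow> 'a mat" where
  "scalar_mat a = mat 1 1 (\<lambda>_. a)"

definition bounded_scalar :: "'a::linordered_field \<Rightarrow> bool" where
  "bounded_scalar a \<longleftrightarrow> bounded_mat (scalar_mat a)"

definition bibounded_scalar :: "'a::linordered_field \<Rightarrow> bool" where
  "bibounded_scalar a \<longleftrightarrow> bibounded_mat (scalar_mat a)"

definition minors :: "nat \<Rightarrow> 'a::comm_ring_1 mat \<Rightarrow> 'a set" where
  "minors k A = {det (submatrix A I J) | I J.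
     I \<subseteq> {..<dim_row A} \<and> J \<subseteq> {..<dim_col A} \<and> card I = k \<and> card J = k}"

definition inv_mat :: "'a::field mat \<Rightarrow> 'a mat" where
  "inv_mat A = the (mat_inverse A)"

lemma inv_mat_inverts:
  fixes A :: "'a::field mat"
  assumes A: "A \<in> carrier_mat n n" and inv: "invertible_mat A"
  shows "inv_mat A \<in> carrier_mat n n" "A * inv_mat A = 1\<^sub>m n" "inv_mat A * A = 1\<^sub>m n"
proof -
  obtain B where B: "inverts_mat A B" "inverts_mat B A"
    using inv unfolding invertible_mat_def by blast
  have AB: "A * B = 1\<^sub>m n" and BA: "B * A = 1\<^sub>m (dim_row B)"
    using A B unfolding inverts_mat_def by auto
  have "dim_col B = n" using arg_cong[OF AB, of dim_col] by simp
  moreover have "dim_row B = n" using arg_cong[OF BA, of dim_col] A by simp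
  ultimately have "B \<in> carrier_mat n n" by auto
  with A AB BA have "A \<in> Units (ring_mat TYPE('a) n ())"
    unfolding Units_def ring_mat_def by auto
  with mat_inverse(1)[OF A, where b = "()"] obtain C where C: "mat_inverse A = Some C"
    by (cases "mat_inverse A") auto
  with mat_inverse(2)[OF A C]
  show "inv_mat A \<in> carrier_mat n n" "A * inv_mat A = 1\<^sub>m n" "inv_mat A * A = 1\<^sub>m n"
    unfolding inv_mat_def by auto
qed

lemma psd_le_1_iff:
  fixes S T :: "'a::linordered_field mat"
  assumes "S \<in> carrier_mat 1 1" "T \<in> carrier_mat 1 1"
  shows "psd_le 1 S T \<longleftrightarrow> S $$ (0,0) \<le> T $$ (0,0)"
proof -
  have sym: "X \<in> sym_mats 1" if "X \<in> carrier_mat 1 1" for X :: "'a mat"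
    using that unfolding sym_mats_def by (auto intro!: eq_matI)
  have q: "v \<bullet> ((T - S) *\<^sub>v v) = (T $$ (0,0) - S $$ (0,0)) * (v $ 0 * v $ 0)"
    if "v \<in> carrier_vec 1" for v
    using that assms by (simp add: scalar_prod_def)
  have "(\<forall>v\<in>carrier_vec 1. 0 \<le> v \<bullet> ((T - S) *\<^sub>v v)) \<longleftrightarrow> S $$ (0,0) \<le> T $$ (0,0)"
  proof
    assume "\<forall>v\<in>carrier_vec 1. 0 \<le> v \<bullet> ((T - S) *\<^sub>v v)"
    then have "0 \<le> vec 1 (\<lambda>_. 1) \<bullet> ((T - S) *\<^sub>v vec 1 (\<lambda>_. 1))"
      by (rule bspec) simp
    then show "S $$ (0,0) \<le> T $$ (0,0)"
      using q[of "vec 1 (\<lambda>_. 1)"] by simp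
  next
    assume "S $$ (0,0) \<le> T $$ (0,0)"
    then show "\<forall>v\<in>carrier_vec 1. 0 \<le> v \<bullet> ((T - S) *\<^sub>v v)"
      using q by (metis diff_ge_0_iff_ge mult_nonneg_nonneg zero_le_square)
  qed
  then show ?thesis
    using assms sym minus_carrier_mat[OF assms(1), of T] unfolding psd_le_def psd_mat_def by simp
qed

lemma mat_succeq_scalar_iff:
  fixes a b :: "'a::linordered_field"
  shows "mat_succeq 1 (scalar_mat a) (scalar_mat b) \<longleftrightarrow> (\<exists>r::nat. a\<^sup>2 \<le> of_nat r * b\<^sup>2)"
proof -
  have "scalar_mat c \<in> mats 1" for c :: 'a
    unfolding mats_def scalar_mat_def by (auto intro!: bexI[of _ 1])
  moreover have "psd_le 1 (transpose_mat (scalar_mat a) * scalar_mat a)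
      (of_nat r \<cdot>\<^sub>m (transpose_mat (scalar_mat b) * scalar_mat b)) \<longleftrightarrow> a\<^sup>2 \<le> of_nat r * b\<^sup>2" for r :: nat
    by (subst psd_le_1_iff) (auto simp: scalar_mat_def scalar_prod_def power2_eq_square)
  ultimately show ?thesis unfolding mat_succeq_def by simp
qed

lemma one_mat_1_eq_scalar_mat: "1\<^sub>m 1 = scalar_mat (1::'a::linordered_field)"
  unfolding scalar_mat_def by (auto intro!: eq_matI)

lemma bounded_scalar_iff:
  fixes a :: "'a::linordered_field"
  shows "bounded_scalar a \<longleftrightarrow> (\<exists>r::nat. \<bar>a\<bar> \<le> of_nat r)"
proof -
  have "bounded_scalar a \<longleftrightarrow> (\<exists>r::nat. a\<^sup>2 \<le> of_nat r)"
    using mat_succeq_scalar_iff[of a 1]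
    unfolding bounded_scalar_def bounded_mat_def one_mat_1_eq_scalar_mat[symmetric]
    by (simp add: scalar_mat_def)
  also have "\<dots> \<longleftrightarrow> (\<exists>r::nat. \<bar>a\<bar> \<le> of_nat r)"
  proof
    assume "\<exists>r::nat. a\<^sup>2 \<le> of_nat r"
    then obtain r :: nat where r: "a\<^sup>2 \<le> of_nat r" ..
    have "(of_nat r :: 'a) \<le> (of_nat (Suc r))\<^sup>2"
      unfolding of_nat_power[symmetric] of_nat_le_iff by (simp add: power2_eq_square)
    with r have "\<bar>a\<bar>\<^sup>2 \<le> (of_nat (Suc r))\<^sup>2" by simp
    then have "\<bar>a\<bar> \<le> of_nat (Suc r)" using of_nat_0_le_iff power2_le_imp_le by blast
    then show "\<exists>r::nat. \<bar>a\<bar> \<le> of_nat r" ..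
  next
    assume "\<exists>r::nat. \<bar>a\<bar> \<le> of_nat r"
    then obtain r :: nat where "\<bar>a\<bar> \<le> of_nat r" ..
    then have "\<bar>a\<bar>\<^sup>2 \<le> (of_nat r)\<^sup>2" by (intro power_mono) auto
    then have "a\<^sup>2 \<le> of_nat (r\<^sup>2)" by simp
    then show "\<exists>r::nat. a\<^sup>2 \<le> of_nat r" ..
  qed
  finally show ?thesis .
qed

lemma bibounded_scalar_iff:
  fixes a :: "'a::linordered_field"
  shows "bibounded_scalar a \<longleftrightarrow> a \<noteq> 0 \<and> bounded_scalar a \<and> bounded_scalar (inverse a)"
proof -
  have bdd: "bounded_scalar c \<longleftrightarrow> (\<exists>r::nat. c\<^sup>2 \<le> of_nat r)" for c :: 'a
    using mat_succeq_scalar_iff[of c 1]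
    unfolding bounded_scalar_def bounded_mat_def one_mat_1_eq_scalar_mat[symmetric]
    by (simp add: scalar_mat_def)
  have "bibounded_scalar a \<longleftrightarrow> bounded_scalar a \<and> (\<exists>r::nat. 1 \<le> of_nat r * a\<^sup>2)"
    using mat_succeq_scalar_iff[of 1 a]
    unfolding bibounded_scalar_def bibounded_mat_def mat_sim_def bounded_scalar_def bounded_mat_def
      one_mat_1_eq_scalar_mat[symmetric]
    by (simp add: scalar_mat_def)
  moreover have "1 \<le> of_nat r * a\<^sup>2 \<longleftrightarrow> a \<noteq> 0 \<and> (inverse a)\<^sup>2 \<le> of_nat r" for r :: nat
    by (cases "a = 0") (auto simp: field_simps)
  ultimately show ?thesis using bdd by auto
qed

end

theory Submission
  imports Defs "HOL-Analysis.Convex"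
begin

text \<open>
  The bounded scalars form a ring that contains every integer, so that determinants and adjugates
  of matrices with bounded entries are again bounded. The relation
  \<^term>\<open>mat_succeq n A B\<close> says that the squared norm of \<^term>\<open>A *\<^sub>v v\<close> is at most a natural
  multiple of that of \<^term>\<open>B *\<^sub>v v\<close>, for all \<^term>\<open>v\<close> with the same multiple
  (\<open>mat_succeq_iff_norm\<close>). Unit vectors and the Cauchy-Schwarz inequality then give
  the description of bounded matrices by their entries (\<open>bounded_mat_iff_entries\<close>).

  A bounded matrix with a bounded left inverse is bibounded, because \<open>C * B\<close> is bounded in terms
  of \<open>B\<close> whenever \<open>C\<close> is bounded
  (\<open>mat_succeq_mult_left\<close>). If the rows of \<open>A\<close> with index in \<open>I\<close> form a square matrix \<open>S\<close> with
  bibounded determinant, then \<open>S\<close> has the bounded inverse adjugate over determinant, which becomes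
  a bounded left inverse of \<open>A\<close> after composition with the selection of the rows in \<open>I\<close>.

  For the converse let \<open>A\<close> be bibounded. By Cauchy-Schwarz its Gram matrix has a bounded inverse \<open>H\<close>
  (\<open>bounded_inverse_of_gram\<close>). Expanding the determinant of the Gram matrix along its rows
  (\<open>det_mult_expand_rows\<close>, a cheap form of the Cauchy-Binet formula) and multiplying by
  \<open>det H\<close> writes \<open>1\<close> as a combination, with bounded coefficients, of determinants of
  \<open>n\<close> selected rows of \<open>A\<close>. The bounded scalars that are not bibounded are infinitesimal, hence one
  of these determinants is bibounded (\<open>bibounded_scalar_if_combination_eq_1\<close>). It is nonzero, so the
  selected rows are distinct and it is a minor up to sign, which also shows \<open>n \<le> m\<close>.
\<close>

unbundle no inner_syntax

section \<open>The ring of bounded scalars\<close>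

lemma bounded_scalar_mono: "\<bar>a\<bar> \<le> \<bar>b\<bar> \<Longrightarrow> bounded_scalar b \<Longrightarrow> bounded_scalar a"
  unfolding bounded_scalar_iff by (meson order_trans)

lemma bounded_scalar_of_nat: "bounded_scalar (of_nat r)"
  unfolding bounded_scalar_iff by auto

lemma bounded_scalar_0: "bounded_scalar 0" and bounded_scalar_1: "bounded_scalar 1"
  using bounded_scalar_of_nat[of 0] bounded_scalar_of_nat[of 1] by simp_all

lemma bounded_scalar_add:
  assumes "bounded_scalar a" "bounded_scalar b"
  shows "bounded_scalar (a + b)"
proof -
  obtain r s :: nat where "\<bar>a\<bar> \<le> of_nat r" "\<bar>b\<bar> \<le> of_nat s"
    using assms unfolding bounded_scalar_iff by blast
  then have "\<bar>a + b\<bar> \<le> of_nat (r + s)" by auto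
  then show ?thesis unfolding bounded_scalar_iff by blast
qed

lemma bounded_scalar_mult:
  assumes "bounded_scalar a" "bounded_scalar b"
  shows "bounded_scalar (a * b)"
proof -
  obtain r s :: nat where "\<bar>a\<bar> \<le> of_nat r" "\<bar>b\<bar> \<le> of_nat s"
    using assms unfolding bounded_scalar_iff by blast
  then have "\<bar>a * b\<bar> \<le> of_nat (r * s)" unfolding abs_mult of_nat_mult by (intro mult_mono) auto
  then show ?thesis unfolding bounded_scalar_iff by blast
qed

lemma bounded_scalar_sum: "(\<And>i. i \<in> I \<Longrightarrow> bounded_scalar (f i)) \<Longrightarrow> bounded_scalar (sum f I)"
  by (induction I rule: infinite_finite_induct) (auto intro: bounded_scalar_0 bounded_scalar_add)

lemma bounded_scalar_prod: "(\<And>i. i \<in> I \<Longrightarrow> bounded_scalar (f i)) \<Longrightarrow> bounded_scalar (prod f I)"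
  by (induction I rule: infinite_finite_induct) (auto intro: bounded_scalar_1 bounded_scalar_mult)

lemma bounded_scalar_det:
  assumes A: "A \<in> carrier_mat n n"
    and bdd: "\<And>i j. i < n \<Longrightarrow> j < n \<Longrightarrow> bounded_scalar (A $$ (i, j))"
  shows "bounded_scalar (det A)"
  unfolding det_def'[OF A]
proof (rule bounded_scalar_sum, rule bounded_scalar_mult)
  fix p assume p: "p \<in> {p. p permutes {0..<n}}"
  show "bounded_scalar (of_int (sign p))"
    by (rule bounded_scalar_mono[OF _ bounded_scalar_1], cases p rule: sign_cases) auto
  show "bounded_scalar (\<Prod>i = 0..<n. A $$ (i, p i))"
    using p by (intro bounded_scalar_prod bdd) auto
qed

lemma bounded_scalar_adj_mat:
  assumes A: "A \<in> carrier_mat n n"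
    and bdd: "\<And>i j. i < n \<Longrightarrow> j < n \<Longrightarrow> bounded_scalar (A $$ (i, j))"
    and i: "i < n" and j: "j < n"
  shows "bounded_scalar (adj_mat A $$ (i, j))"
proof -
  have "bounded_scalar (det (mat_delete A j i))"
    using A i j by (intro bounded_scalar_det[of _ "n - 1"]) (auto simp: mat_delete_def intro!: bdd)
  moreover have "\<bar>cofactor A j i\<bar> = \<bar>det (mat_delete A j i)\<bar>"
    by (simp add: cofactor_def abs_mult power_abs)
  ultimately show ?thesis
    using A i j bounded_scalar_mono[of "cofactor A j i" "det (mat_delete A j i)"]
    by (simp add: adj_mat_def)
qed

text \<open>
  The bounded scalars form a local ring: those that are not bibounded have absolute value
  at most \<open>1 / k\<close> for every positive natural \<open>k\<close>, and a sum of bounded multiples of such scalars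
  cannot reach \<open>1\<close>.
\<close>

lemma bibounded_scalar_if_combination_eq_1:
  assumes c: "\<And>i. i \<in> I \<Longrightarrow> bounded_scalar (c i)"
    and d: "\<And>i. i \<in> I \<Longrightarrow> bounded_scalar (d i)"
    and eq: "(\<Sum>i\<in>I. c i * d i) = (1::'a::linordered_field)"
  shows "\<exists>i\<in>I. bibounded_scalar (d i)"
proof (rule ccontr)
  assume contra: "\<not> ?thesis"
  have "bounded_scalar (\<Sum>i\<in>I. \<bar>c i\<bar>)"
    using c by (intro bounded_scalar_sum bounded_scalar_mono[OF _ c]) auto
  then obtain r :: nat where "\<bar>\<Sum>i\<in>I. \<bar>c i\<bar>\<bar> \<le> of_nat r" unfolding bounded_scalar_iff by blast
  then have r: "(\<Sum>i\<in>I. \<bar>c i\<bar>) \<le> of_nat r" by linarith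
  have small: "\<bar>d i\<bar> \<le> 1 / of_nat (Suc r)" if i: "i \<in> I" for i
  proof (rule ccontr)
    assume big: "\<not> \<bar>d i\<bar> \<le> 1 / of_nat (Suc r)"
    then have "\<bar>d i\<bar> > 1 / of_nat (Suc r)" by simp
    then have "1 < \<bar>d i\<bar> * of_nat (Suc r)" by (subst (asm) pos_divide_less_eq)
        (simp_all only: of_nat_0_less_iff zero_less_Suc)
    moreover have "d i \<noteq> 0" using big by auto
    ultimately have "\<bar>inverse (d i)\<bar> \<le> of_nat (Suc r)"
      unfolding abs_inverse by (simp only: inverse_eq_divide) (simp add: divide_simps mult.commute)
    then have "bounded_scalar (inverse (d i))" unfolding bounded_scalar_iff by blast
    with contra i \<open>d i \<noteq> 0\<close> d[OF i] show False unfolding bibounded_scalar_iff by blast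
  qed
  have "1 \<le> (\<Sum>i\<in>I. \<bar>c i * d i\<bar>)" using sum_abs[of "\<lambda>i. c i * d i" I] unfolding eq by simp
  also have "\<dots> \<le> (\<Sum>i\<in>I. \<bar>c i\<bar> * (1 / of_nat (Suc r)))"
    unfolding abs_mult by (intro sum_mono mult_left_mono small) auto
  also have "\<dots> = (\<Sum>i\<in>I. \<bar>c i\<bar>) / of_nat (Suc r)" by (simp add: sum_divide_distrib)
  also have "\<dots> \<le> of_nat r / of_nat (Suc r)" using r by (intro divide_right_mono) auto
  also have "\<dots> < 1" by (subst divide_less_eq_1_pos)
      (simp_all only: of_nat_0_less_iff zero_less_Suc of_nat_less_iff lessI)
  finally show False by simp
qed

section \<open>The preorder in terms of squared norms\<close>

lemma scalar_prod_self: "v \<bullet> v = (\<Sum>i<dim_vec v. (v $ i :: 'a::comm_ring_1)\<^sup>2)"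
  unfolding scalar_prod_def atLeast0LessThan power2_eq_square ..

lemma scalar_prod_self_nonneg: "0 \<le> v \<bullet> (v :: 'a::linordered_field vec)"
  unfolding scalar_prod_self by (simp add: sum_nonneg)

lemma scalar_prod_self_eq_0:
  fixes v :: "'a::linordered_field vec"
  assumes "v \<in> carrier_vec n" "v \<bullet> v = 0"
  shows "v = 0\<^sub>v n"
  using assms unfolding scalar_prod_self by (subst (asm) sum_nonneg_eq_0_iff) (auto intro!: eq_vecI)

lemma scalar_prod_Cauchy_Schwarz:
  fixes v w :: "'a::linordered_field vec"
  assumes "dim_vec v = dim_vec w"
  shows "(v \<bullet> w)\<^sup>2 \<le> (v \<bullet> v) * (w \<bullet> w)"
  using Cauchy_Schwarz_ineq_sum[of "\<lambda>i. v $ i" "\<lambda>i. w $ i" "{..<dim_vec w}"] assms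
  unfolding scalar_prod_self by (simp add: scalar_prod_def atLeast0LessThan)

lemma scalar_prod_gram:
  fixes A :: "'a::comm_ring_1 mat"
  assumes A: "A \<in> carrier_mat m n" and v: "v \<in> carrier_vec n" and w: "w \<in> carrier_vec n"
  shows "w \<bullet> ((A\<^sup>T * A) *\<^sub>v v) = (A *\<^sub>v w) \<bullet> (A *\<^sub>v v)"
proof -
  have "w \<bullet> (A\<^sup>T *\<^sub>v (A *\<^sub>v v)) = (A\<^sup>T *\<^sub>v (A *\<^sub>v v)) \<bullet> w"
    using A v w by (intro comm_scalar_prod[of _ n]) auto
  also have "\<dots> = (A *\<^sub>v v) \<bullet> (A *\<^sub>v w)"
    using A v w by (intro transpose_vec_mult_scalar[of _ m n]) auto
  also have "\<dots> = (A *\<^sub>v w) \<bullet> (A *\<^sub>v v)"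
    using A v w by (intro comm_scalar_prod[of _ m]) auto
  finally show ?thesis using A v assoc_mult_mat_vec[of "A\<^sup>T" n m A n v] by simp
qed

text \<open>
  The quadratic form of the Gram matrix at \<open>v\<close> is the squared norm of \<open>A *\<^sub>v v\<close>. This turns the
  matrix inequality into a family of scalar ones.
\<close>

lemma mat_succeq_iff_norm:
  fixes A B :: "'a::linordered_field mat"
  assumes A: "A \<in> carrier_mat m n" and B: "B \<in> carrier_mat k n" and mk: "m \<ge> 1" "k \<ge> 1"
  shows "mat_succeq n A B \<longleftrightarrow>
    (\<exists>r::nat. \<forall>v\<in>carrier_vec n. (A *\<^sub>v v) \<bullet> (A *\<^sub>v v) \<le> of_nat r * ((B *\<^sub>v v) \<bullet> (B *\<^sub>v v)))"
proof -
  have "A \<in> mats n" "B \<in> mats n" using A B mk unfolding mats_def by auto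
  moreover have "psd_le n (A\<^sup>T * A) (of_nat r \<cdot>\<^sub>m (B\<^sup>T * B)) \<longleftrightarrow>
    (\<forall>v\<in>carrier_vec n. (A *\<^sub>v v) \<bullet> (A *\<^sub>v v) \<le> of_nat r * ((B *\<^sub>v v) \<bullet> (B *\<^sub>v v)))" for r :: nat
  proof -
    let ?G = "A\<^sup>T * A" and ?H = "of_nat r \<cdot>\<^sub>m (B\<^sup>T * B)"
    have G: "?G \<in> carrier_mat n n" and H: "?H \<in> carrier_mat n n" using A B by auto
    have symG: "?G\<^sup>T = ?G" using A transpose_mult[of "A\<^sup>T" n m A n] by simp
    have symB: "(B\<^sup>T * B)\<^sup>T = B\<^sup>T * B" using B transpose_mult[of "B\<^sup>T" n k B n] by simp
    have "?H\<^sup>T = of_nat r \<cdot>\<^sub>m (B\<^sup>T * B)\<^sup>T" by (intro eq_matI) auto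
    then have symH: "?H\<^sup>T = ?H" unfolding symB .
    have "(?H - ?G)\<^sup>T = ?H - ?G" unfolding transpose_minus[OF H G] symG symH ..
    then have sym: "?G \<in> sym_mats n" "?H \<in> sym_mats n" "?H - ?G \<in> sym_mats n"
      using G H symG symH minus_carrier_mat[OF G, of ?H] unfolding sym_mats_def by simp_all
    have "v \<bullet> ((?H - ?G) *\<^sub>v v) = of_nat r * ((B *\<^sub>v v) \<bullet> (B *\<^sub>v v)) - (A *\<^sub>v v) \<bullet> (A *\<^sub>v v)"
      if v: "v \<in> carrier_vec n" for v
    proof -
      have "v \<bullet> ((?H - ?G) *\<^sub>v v) = v \<bullet> (?H *\<^sub>v v) - v \<bullet> (?G *\<^sub>v v)"
        using G H v by (simp add: minus_mult_distrib_mat_vec[of _ n n] scalar_prod_minus_distrib[of _ n])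
      also have "v \<bullet> (?H *\<^sub>v v) = of_nat r * (v \<bullet> ((B\<^sup>T * B) *\<^sub>v v))"
      proof -
        have "(c \<cdot>\<^sub>m M) *\<^sub>v v = c \<cdot>\<^sub>v (M *\<^sub>v v)" if "M \<in> carrier_mat n n" for c :: 'a and M
          using that v by (intro eq_vecI) auto
        from this[of "B\<^sup>T * B" "of_nat r"] show ?thesis using B v by simp
      qed
      finally show ?thesis using scalar_prod_gram[OF A v v] scalar_prod_gram[OF B v v] by simp
    qed
    then show ?thesis unfolding psd_le_def psd_mat_def using sym by auto
  qed
  ultimately show ?thesis unfolding mat_succeq_def by simp
qed

lemma bounded_mat_iff_norm:
  fixes A :: "'a::linordered_field mat"
  assumes A: "A \<in> carrier_mat m n" and mn: "m \<ge> 1" "n \<ge> 1"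
  shows "bounded_mat A \<longleftrightarrow>
    (\<exists>r::nat. \<forall>v\<in>carrier_vec n. (A *\<^sub>v v) \<bullet> (A *\<^sub>v v) \<le> of_nat r * (v \<bullet> v))"
  using mat_succeq_iff_norm[OF A one_carrier_mat mn] A unfolding bounded_mat_def by simp

lemma bibounded_mat_iff:
  assumes "A \<in> carrier_mat m n"
  shows "bibounded_mat A \<longleftrightarrow> bounded_mat A \<and> mat_succeq n (1\<^sub>m n) A"
  using assms unfolding bibounded_mat_def bounded_mat_def mat_sim_def by simp

lemma bounded_mat_iff_entries:
  fixes A :: "'a::linordered_field mat"
  assumes A: "A \<in> carrier_mat m n" and mn: "m \<ge> 1" "n \<ge> 1"
  shows "bounded_mat A \<longleftrightarrow> (\<forall>i<m. \<forall>j<n. bounded_scalar (A $$ (i, j)))"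
proof
  assume "bounded_mat A"
  then obtain r :: nat where
    r: "\<And>v. v \<in> carrier_vec n \<Longrightarrow> (A *\<^sub>v v) \<bullet> (A *\<^sub>v v) \<le> of_nat r * (v \<bullet> v)"
    unfolding bounded_mat_iff_norm[OF assms] by blast
  show "\<forall>i<m. \<forall>j<n. bounded_scalar (A $$ (i, j))"
  proof (intro allI impI)
    fix i j assume i: "i < m" and j: "j < n"
    let ?w = "A *\<^sub>v unit_vec n j"
    have w: "?w $ i = A $$ (i, j)" using A i j by simp
    have "(A $$ (i, j))\<^sup>2 \<le> ?w \<bullet> ?w"
      unfolding scalar_prod_self w[symmetric] using A i by (intro member_le_sum) auto
    also have "\<dots> \<le> of_nat r" using r[of "unit_vec n j"] j by simp
    finally have "(A $$ (i, j))\<^sup>2 \<le> of_nat r" .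
    \<comment> \<open>The field need not have square roots, so \<open>\<bar>x\<bar> \<le> 1 + x\<^sup>2\<close> passes from squares to absolute values.\<close>
    moreover have "\<bar>A $$ (i, j)\<bar> \<le> 1 + (A $$ (i, j))\<^sup>2"
      using zero_le_power2[of "\<bar>A $$ (i, j)\<bar> - 1"] zero_le_power2[of "A $$ (i, j)"]
      unfolding power2_diff by simp
    ultimately have "\<bar>A $$ (i, j)\<bar> \<le> of_nat (Suc r)" by simp
    then show "bounded_scalar (A $$ (i, j))" unfolding bounded_scalar_iff by blast
  qed
next
  assume bdd: "\<forall>i<m. \<forall>j<n. bounded_scalar (A $$ (i, j))"
  \<comment> \<open>The squared Frobenius norm bounds the squared operator norm.\<close>
  let ?s = "\<Sum>i<m. row A i \<bullet> row A i"
  have "bounded_scalar ?s"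
    unfolding scalar_prod_self power2_eq_square using A bdd
    by (intro bounded_scalar_sum bounded_scalar_mult) auto
  then obtain r :: nat where "\<bar>?s\<bar> \<le> of_nat r" unfolding bounded_scalar_iff by blast
  then have r: "?s \<le> of_nat r" by linarith
  have "(A *\<^sub>v v) \<bullet> (A *\<^sub>v v) \<le> of_nat r * (v \<bullet> v)" if v: "v \<in> carrier_vec n" for v
  proof -
    have "(A *\<^sub>v v) \<bullet> (A *\<^sub>v v) = (\<Sum>i<m. (row A i \<bullet> v)\<^sup>2)"
      unfolding scalar_prod_self using A by simp
    also have "\<dots> \<le> (\<Sum>i<m. (row A i \<bullet> row A i) * (v \<bullet> v))"
      using A v by (intro sum_mono scalar_prod_Cauchy_Schwarz) auto
    also have "\<dots> = ?s * (v \<bullet> v)" by (simp add: sum_distrib_right)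
    also have "\<dots> \<le> of_nat r * (v \<bullet> v)" by (intro mult_right_mono r scalar_prod_self_nonneg)
    finally show ?thesis .
  qed
  then show "bounded_mat A" unfolding bounded_mat_iff_norm[OF assms] by blast
qed

text \<open>
  Used with \<open>C * B = 1\<^sub>m n\<close>, this yields lower bounds: the identity is bounded in terms of every
  matrix that has a bounded left inverse.
\<close>

lemma mat_succeq_mult_left:
  fixes B C :: "'a::linordered_field mat"
  assumes C: "C \<in> carrier_mat m k" and B: "B \<in> carrier_mat k n" and mk: "m \<ge> 1" "k \<ge> 1"
    and bdd: "bounded_mat C"
  shows "mat_succeq n (C * B) B"
proof -
  obtain r :: nat where
    r: "\<And>v. v \<in> carrier_vec k \<Longrightarrow> (C *\<^sub>v v) \<bullet> (C *\<^sub>v v) \<le> of_nat r * (v \<bullet> v)"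
    using bdd unfolding bounded_mat_iff_norm[OF C mk] by blast
  have "((C * B) *\<^sub>v v) \<bullet> ((C * B) *\<^sub>v v) \<le> of_nat r * ((B *\<^sub>v v) \<bullet> (B *\<^sub>v v))"
    if "v \<in> carrier_vec n" for v
    using r[of "B *\<^sub>v v"] B C that by simp
  then show ?thesis
    unfolding mat_succeq_iff_norm[OF mult_carrier_mat[OF C B] B mk] by blast
qed

lemma mat_succeq_trans:
  fixes A B C :: "'a::linordered_field mat"
  assumes A: "A \<in> carrier_mat m n" and B: "B \<in> carrier_mat k n" and C: "C \<in> carrier_mat l n"
    and pos: "m \<ge> 1" "k \<ge> 1" "l \<ge> 1"
    and AB: "mat_succeq n A B" and BC: "mat_succeq n B C"
  shows "mat_succeq n A C"
proof -
  obtain r s :: nat where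
    r: "\<And>v. v \<in> carrier_vec n \<Longrightarrow> (A *\<^sub>v v) \<bullet> (A *\<^sub>v v) \<le> of_nat r * ((B *\<^sub>v v) \<bullet> (B *\<^sub>v v))" and
    s: "\<And>v. v \<in> carrier_vec n \<Longrightarrow> (B *\<^sub>v v) \<bullet> (B *\<^sub>v v) \<le> of_nat s * ((C *\<^sub>v v) \<bullet> (C *\<^sub>v v))"
    using AB BC mat_succeq_iff_norm[OF A B] mat_succeq_iff_norm[OF B C] pos by blast
  have "(A *\<^sub>v v) \<bullet> (A *\<^sub>v v) \<le> of_nat (r * s) * ((C *\<^sub>v v) \<bullet> (C *\<^sub>v v))"
    if v: "v \<in> carrier_vec n" for v
    using order_trans[OF r[OF v] mult_left_mono[OF s[OF v], of "of_nat r"]] by (simp add: mult.assoc)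
  then show ?thesis using mat_succeq_iff_norm[OF A C] pos by blast
qed

section \<open>Inverses\<close>

lemma inverse_mat_if_det_nonzero:
  fixes A :: "'a::field mat"
  assumes A: "A \<in> carrier_mat n n" and d: "det A \<noteq> 0"
  defines "H \<equiv> inverse (det A) \<cdot>\<^sub>m adj_mat A"
  shows "H \<in> carrier_mat n n" "A * H = 1\<^sub>m n" "H * A = 1\<^sub>m n"
proof -
  note adj = adj_mat[OF A]
  show "H \<in> carrier_mat n n" using adj unfolding H_def by simp
  have one: "inverse (det A) \<cdot>\<^sub>m (det A \<cdot>\<^sub>m 1\<^sub>m n) = 1\<^sub>m n" using d by (intro eq_matI) auto
  show "A * H = 1\<^sub>m n"
    unfolding H_def mult_smult_distrib[OF A adj(1)] adj(2) by (rule one)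
  show "H * A = 1\<^sub>m n"
    unfolding H_def mult_smult_assoc_mat[OF adj(1) A] adj(3) by (rule one)
qed

text \<open>
  Let \<open>G = A\<^sup>T * A\<close>. The hypothesis says \<open>u \<bullet> u \<le> r * (u \<bullet> (G *\<^sub>v u))\<close>. In particular \<open>G\<close> has no
  kernel. For \<open>u = H *\<^sub>v w\<close> with \<open>H\<close> the inverse of \<open>G\<close> the right-hand side is \<open>r * (u \<bullet> w)\<close>, and
  Cauchy-Schwarz bounds \<open>u\<close> by a multiple of \<open>w\<close>.
\<close>

lemma bounded_inverse_of_gram:
  fixes A :: "'a::linordered_field mat"
  assumes A: "A \<in> carrier_mat m n" and mn: "m \<ge> 1" "n \<ge> 1"
    and dom: "mat_succeq n (1\<^sub>m n) A"
  obtains H where "H \<in> carrier_mat n n" "(A\<^sup>T * A) * H = 1\<^sub>m n" "bounded_mat H"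
proof -
  let ?G = "A\<^sup>T * A"
  have G: "?G \<in> carrier_mat n n" using A by simp
  obtain r :: nat where "\<And>v. v \<in> carrier_vec n \<Longrightarrow> (1\<^sub>m n *\<^sub>v v) \<bullet> (1\<^sub>m n *\<^sub>v v) \<le> of_nat r * ((A *\<^sub>v v) \<bullet> (A *\<^sub>v v))"
    using dom mat_succeq_iff_norm[OF one_carrier_mat A] mn by blast
  then have r: "v \<bullet> v \<le> of_nat r * (v \<bullet> (?G *\<^sub>v v))" if "v \<in> carrier_vec n" for v
    using that scalar_prod_gram[OF A that that] by fastforce
  have "det ?G \<noteq> 0"
  proof
    assume "det ?G = 0"
    then obtain v where v: "v \<in> carrier_vec n" "v \<noteq> 0\<^sub>v n" "?G *\<^sub>v v = 0\<^sub>v n"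
      unfolding det_0_iff_vec_prod_zero_field[OF G] by blast
    then have "v \<bullet> v \<le> 0" using r[OF v(1)] by simp
    then show False using v scalar_prod_self_eq_0[OF v(1)] scalar_prod_self_nonneg[of v] by simp
  qed
  then obtain H where H: "H \<in> carrier_mat n n" "?G * H = 1\<^sub>m n"
    using inverse_mat_if_det_nonzero[OF G] by blast
  have "(H *\<^sub>v w) \<bullet> (H *\<^sub>v w) \<le> of_nat (r\<^sup>2) * (w \<bullet> w)" if w: "w \<in> carrier_vec n" for w
  proof -
    let ?u = "H *\<^sub>v w"
    have u: "?u \<in> carrier_vec n" using H w by simp
    have "?G *\<^sub>v ?u = w" using assoc_mult_mat_vec[OF G H(1) w] H(2) w by simp
    then have "?u \<bullet> ?u \<le> of_nat r * (?u \<bullet> w)" using r[OF u] by simp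
    then have "(?u \<bullet> ?u)\<^sup>2 \<le> (of_nat r * (?u \<bullet> w))\<^sup>2"
      by (intro power_mono scalar_prod_self_nonneg)
    also have "\<dots> \<le> of_nat (r\<^sup>2) * ((?u \<bullet> ?u) * (w \<bullet> w))"
      unfolding power_mult_distrib of_nat_power using H(1) w
      by (intro mult_left_mono scalar_prod_Cauchy_Schwarz) auto
    finally have le: "(?u \<bullet> ?u) * (?u \<bullet> ?u) \<le> (?u \<bullet> ?u) * (of_nat (r\<^sup>2) * (w \<bullet> w))"
      by (simp add: power2_eq_square ac_simps)
    show ?thesis
    proof (cases "?u \<bullet> ?u = 0")
      case True
      then show ?thesis using scalar_prod_self_nonneg[of w] by simp
    next
      case False
      then have "0 < ?u \<bullet> ?u" using scalar_prod_self_nonneg[of ?u] by simp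
      with le show ?thesis using mult_le_cancel_left_pos by blast
    qed
  qed
  then have "bounded_mat H" unfolding bounded_mat_iff_norm[OF H(1) mn(2) mn(2)] by blast
  with H that show thesis by blast
qed

section \<open>Determinants of row selections\<close>

text \<open>
  Row \<open>i\<close> of \<open>B * A\<close> is the combination of the rows of \<open>A\<close> with coefficients from row \<open>i\<close> of \<open>B\<close>,
  and the determinant is linear in each row. The summation functions choose a row of \<open>A\<close> for each
  \<open>i\<close>; they are fixed to the identity beyond \<open>n\<close> so that every choice is counted once.
  Grouping the injective choices by their image would give the Cauchy-Binet formula.
\<close>

lemma det_mult_expand_rows:
  fixes B :: "'a::comm_ring_1 mat"
  assumes B: "B \<in> carrier_mat n m" and A: "A \<in> carrier_mat m n"
  shows "det (B * A) =
    (\<Sum>f | (\<forall>i\<in>{0..<n}. f i \<in> {0..<m}) \<and> (\<forall>i. i \<notin> {0..<n} \<longrightarrow> f i = i).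
       (\<Prod>i = 0..<n. B $$ (i, f i)) * det (mat n n (\<lambda>(i, j). A $$ (f i, j))))"
    (is "_ = sum _ ?F")
proof -
  have "det (B * A) = (\<Sum>f\<in>?F. det (mat\<^sub>r n n (\<lambda>i. B $$ (i, f i) \<cdot>\<^sub>v row A (f i))))"
    unfolding mat_mul_finsum_alt[OF B A] by (rule det_linear_rows_sum) (use A in auto)
  also have "\<dots> = (\<Sum>f\<in>?F. (\<Prod>i = 0..<n. B $$ (i, f i)) * det (mat n n (\<lambda>(i, j). A $$ (f i, j))))"
  proof (rule sum.cong[OF refl])
    fix f assume f: "f \<in> ?F"
    have "mat\<^sub>r n n (\<lambda>i. row A (f i)) = mat n n (\<lambda>(i, j). A $$ (f i, j))"
      using A f by (intro eq_matI) auto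
    then show "det (mat\<^sub>r n n (\<lambda>i. B $$ (i, f i) \<cdot>\<^sub>v row A (f i)))
      = (\<Prod>i = 0..<n. B $$ (i, f i)) * det (mat n n (\<lambda>(i, j). A $$ (f i, j)))"
      using A det_rows_mul[of "\<lambda>i. row A (f i)" n "\<lambda>i. B $$ (i, f i)"]
      by (auto simp: carrier_vecI)
  qed
  finally show ?thesis .
qed

lemma pick_lessThan: "j < n \<Longrightarrow> pick {..<n} j = j"
proof -
  assume "j < n"
  moreover from this have "{a \<in> {..<n}. a < j} = {..<j}" by auto
  ultimately show ?thesis using pick_card_in_set[of j "{..<n}"] by simp
qed

lemma submatrix_full_columns:
  assumes A: "A \<in> carrier_mat m n" and I: "I \<subseteq> {..<m}"
  shows "submatrix A I {..<n} = mat (card I) n (\<lambda>(i, j). A $$ (pick I i, j))"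
proof -
  have "{i. i < dim_row A \<and> i \<in> I} = I" "{j. j < dim_col A \<and> j \<in> {..<n}} = {..<n}"
    using A I by auto
  then show ?thesis
    by (intro eq_matI) (simp_all add: dim_submatrix submatrix_index pick_lessThan)
qed

text \<open>
  Repeated rows would make the determinant vanish, so \<open>f\<close> is injective below \<open>n\<close>. The minor on the
  rows \<open>f ` {..<n}\<close> lists the same rows in increasing order, and sorting changes the determinant
  by the sign of a permutation.
\<close>

lemma det_row_selection_eq_minor:
  fixes A :: "'a::linordered_idom mat"
  assumes A: "A \<in> carrier_mat m n" and f: "\<And>i. i < n \<Longrightarrow> f i < m"
    and d: "det (mat n n (\<lambda>(i, j). A $$ (f i, j))) \<noteq> 0"
  shows "n \<le> m" and "\<exists>d\<in>minors n A. \<bar>d\<bar> = \<bar>det (mat n n (\<lambda>(i, j). A $$ (f i, j)))\<bar>"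
proof -
  let ?R = "mat n n (\<lambda>(i, j). A $$ (f i, j))"
  have inj: "inj_on f {..<n}"
  proof (rule inj_onI, rule ccontr)
    fix i j assume ij: "i \<in> {..<n}" "j \<in> {..<n}" "f i = f j" "i \<noteq> j"
    then have "row ?R i = row ?R j" by (intro eq_vecI) auto
    then show False using det_identical_rows[of ?R n i j] ij d by simp
  qed
  define I where "I = f ` {..<n}"
  have I: "I \<subseteq> {..<m}" using f unfolding I_def by auto
  have cI: "card I = n" unfolding I_def by (simp add: card_image[OF inj])
  show "n \<le> m" using card_mono[OF _ I] cI by simp
  \<comment> \<open>The position of \<open>f i\<close> in \<open>I\<close>, so that \<open>pick I\<close> undoes it.\<close>
  define g where "g i = (if i < n then card {a \<in> I. a < f i} else i)" for i
  have pick: "pick I (g i) = f i" if "i < n" for i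
    unfolding g_def using that pick_card_in_set[of "f i" I] I_def by simp
  have g: "g i < n" if "i < n" for i
  proof -
    have "finite I" unfolding I_def by simp
    moreover have "{a \<in> I. a < f i} \<subset> I" using that unfolding I_def by auto
    ultimately have "card {a \<in> I. a < f i} < card I" by (rule psubset_card_mono)
    then show ?thesis unfolding cI g_def using that by simp
  qed
  have "inj_on g {..<n}"
    using inj pick unfolding inj_on_def by (metis lessThan_iff)
  then have p: "g permutes {0..<n}"
    using g by (intro inj_on_nat_permutes) (auto simp: atLeast0LessThan g_def)
  let ?S = "submatrix A I {..<n}"
  have S: "?S = mat n n (\<lambda>(i, j). A $$ (pick I i, j))"
    using submatrix_full_columns[OF A I] cI by simp
  have "?R = mat n n (\<lambda>(i, j). ?S $$ (g i, j))"
    unfolding S by (intro eq_matI) (auto simp: g pick)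
  moreover have "?S \<in> carrier_mat n n" unfolding S by simp
  ultimately have "det ?R = of_int (sign g) * det ?S"
    using det_permute_rows[OF _ p, of ?S] by simp
  then have "\<bar>det ?S\<bar> = \<bar>det ?R\<bar>" by (cases g rule: sign_cases) auto
  moreover have "det ?S \<in> minors n A"
    unfolding minors_def mem_Collect_eq using A I cI
    by (intro exI[of _ I] exI[of _ "{..<n}"]) auto
  ultimately show "\<exists>d\<in>minors n A. \<bar>d\<bar> = \<bar>det ?R\<bar>" by blast
qed

section \<open>Bibounded matrices\<close>

lemma bibounded_minor_if_bibounded_mat:
  fixes A :: "'a::linordered_field mat"
  assumes A: "A \<in> carrier_mat m n" and mn: "m \<ge> 1" "n \<ge> 1" and bib: "bibounded_mat A"
  shows "n \<le> m \<and> (\<exists>d\<in>minors n A. bibounded_scalar d)"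
proof -
  have "bounded_mat A" and dom: "mat_succeq n (1\<^sub>m n) A"
    using bib bibounded_mat_iff[OF A] by auto
  then have bdd: "bounded_scalar (A $$ (i, j))" if "i < m" "j < n" for i j
    using bounded_mat_iff_entries[OF A mn] that by simp
  obtain H where H: "H \<in> carrier_mat n n" "(A\<^sup>T * A) * H = 1\<^sub>m n" "bounded_mat H"
    using bounded_inverse_of_gram[OF A mn dom] .
  have detH: "bounded_scalar (det H)"
    using H bounded_mat_iff_entries[OF H(1) mn(2) mn(2)] by (intro bounded_scalar_det[OF H(1)]) auto
  let ?F = "{f. (\<forall>i\<in>{0..<n}. f i \<in> {0..<m}) \<and> (\<forall>i. i \<notin> {0..<n} \<longrightarrow> f i = i)}"
  let ?c = "\<lambda>f. det H * (\<Prod>i = 0..<n. A\<^sup>T $$ (i, f i))"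
  let ?R = "\<lambda>f. mat n n (\<lambda>(i, j). A $$ (f i, j))"
  have "1 = det (A\<^sup>T * A) * det H"
    using det_mult[of "A\<^sup>T * A" n H] A H by simp
  also have "\<dots> = (\<Sum>f\<in>?F. ?c f * det (?R f))"
    using A by (subst det_mult_expand_rows[of _ n m]) (auto simp: sum_distrib_left ac_simps)
  finally have "(\<Sum>f\<in>?F. ?c f * det (?R f)) = 1" by simp
  moreover have "bounded_scalar (?c f)" "bounded_scalar (det (?R f))" if f: "f \<in> ?F" for f
    using A f by (auto intro!: bounded_scalar_mult detH bounded_scalar_prod bounded_scalar_det[of _ n] bdd)
  ultimately obtain f where f: "f \<in> ?F" and df: "bibounded_scalar (det (?R f))"
    using bibounded_scalar_if_combination_eq_1[of ?F ?c "\<lambda>f. det (?R f)"] by blast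
  have "det (?R f) \<noteq> 0" using df unfolding bibounded_scalar_iff by blast
  with f have *: "n \<le> m" "\<exists>d\<in>minors n A. \<bar>d\<bar> = \<bar>det (?R f)\<bar>"
    using det_row_selection_eq_minor[OF A, of f] by auto
  then obtain d where d: "d \<in> minors n A" "\<bar>d\<bar> = \<bar>det (?R f)\<bar>" by blast
  have "bibounded_scalar d"
    using df d(2) bounded_scalar_mono[of d "det (?R f)"]
      bounded_scalar_mono[of "inverse d" "inverse (det (?R f))"]
    unfolding bibounded_scalar_iff by (auto simp: abs_inverse)
  with * d show ?thesis by blast
qed

lemma bibounded_mat_if_bibounded_minor:
  fixes A :: "'a::linordered_field mat"
  assumes A: "A \<in> carrier_mat m n" and mn: "m \<ge> 1" "n \<ge> 1" and bA: "bounded_mat A"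
    and d: "d \<in> minors n A" and bib: "bibounded_scalar d"
  shows "bibounded_mat A"
proof -
  have bdd: "bounded_scalar (A $$ (i, j))" if "i < m" "j < n" for i j
    using bA bounded_mat_iff_entries[OF A mn] that by simp
  obtain I J where IJ: "I \<subseteq> {..<m}" "J \<subseteq> {..<n}" "card I = n" "card J = n"
    and dS: "d = det (submatrix A I J)"
    using d A unfolding minors_def by auto
  have "J = {..<n}" using IJ by (intro card_subset_eq) auto
  define S where "S = submatrix A I J"
  have S: "S = mat n n (\<lambda>(i, j). A $$ (pick I i, j))"
    unfolding S_def \<open>J = _\<close> using submatrix_full_columns[OF A IJ(1)] IJ(3) by simp
  then have Sc: "S \<in> carrier_mat n n" by simp
  have pick: "pick I i < m" if "i < n" for i
    using pick_in_set_le[of i I] that IJ by auto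
  have bS: "bounded_scalar (S $$ (i, j))" if "i < n" "j < n" for i j
    using that pick unfolding S by (auto intro: bdd)
  \<comment> \<open>The 0-1 matrix that selects the rows in \<open>I\<close>.\<close>
  let ?P = "mat n m (\<lambda>(i, k). if k = pick I i then 1 else 0) :: 'a mat"
  have P: "?P \<in> carrier_mat n m" by simp
  have "S = ?P * A"
  proof (rule eq_matI)
    fix i j assume "i < dim_row (?P * A)" "j < dim_col (?P * A)"
    then show "S $$ (i, j) = (?P * A) $$ (i, j)"
      using A pick[of i] unfolding S
      by (auto simp: scalar_prod_def if_distrib[of "\<lambda>x. x * _"] sum.delta cong: if_cong)
  qed (use A S in auto)
  moreover have "bounded_mat ?P"
    unfolding bounded_mat_iff_entries[OF P mn(2,1)] by (auto intro: bounded_scalar_0 bounded_scalar_1)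
  ultimately have SA: "mat_succeq n S A" using mat_succeq_mult_left[OF P A mn(2,1)] by simp
  have nz: "det S \<noteq> 0" and inv: "bounded_scalar (inverse (det S))"
    using bib unfolding dS S_def bibounded_scalar_iff by auto
  let ?H = "inverse (det S) \<cdot>\<^sub>m adj_mat S"
  note H = inverse_mat_if_det_nonzero[OF Sc nz]
  have "bounded_mat ?H"
    unfolding bounded_mat_iff_entries[OF H(1) mn(2,2)]
    using adj_mat(1)[OF Sc] by (auto intro!: bounded_scalar_mult inv bounded_scalar_adj_mat[OF Sc bS])
  then have "mat_succeq n (1\<^sub>m n) S"
    using mat_succeq_mult_left[OF H(1) Sc mn(2,2)] H(3) by simp
  then have "mat_succeq n (1\<^sub>m n) A"
    using mat_succeq_trans[OF one_carrier_mat Sc A mn(2,2,1) _ SA] by blast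
  with bA show ?thesis unfolding bibounded_mat_iff[OF A] by blast
qed

text \<open>
  For square \<open>A\<close> the lower bound on the norm of \<open>A *\<^sub>v v\<close>, read at \<open>v = inv_mat A *\<^sub>v w\<close>, is an upper
  bound for \<open>inv_mat A\<close>; conversely \<open>inv_mat A\<close> is a left inverse.
\<close>

lemma bibounded_square_mat_iff:
  fixes A :: "'a::linordered_field mat"
  assumes A: "A \<in> carrier_mat n n" and n: "n \<ge> 1"
  shows "bibounded_mat A \<longleftrightarrow> invertible_mat A \<and> bounded_mat A \<and> bounded_mat (inv_mat A)"
proof
  assume bib: "bibounded_mat A"
  then have bA: "bounded_mat A" and dom: "mat_succeq n (1\<^sub>m n) A"
    using bibounded_mat_iff[OF A] by auto
  obtain H where H: "H \<in> carrier_mat n n" "(A\<^sup>T * A) * H = 1\<^sub>m n"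
    using bounded_inverse_of_gram[OF A n n dom] .
  \<comment> \<open>The Gram matrix is invertible, and \<open>det A\<close> divides its determinant.\<close>
  have "det A \<noteq> 0"
    using arg_cong[OF H(2), of det] det_mult[of "A\<^sup>T * A" n H] det_mult[of "A\<^sup>T" n A] A H(1) by auto
  from inverse_mat_if_det_nonzero[OF A this] A have inv: "invertible_mat A"
    unfolding invertible_mat_def inverts_mat_def by auto
  note I = inv_mat_inverts[OF A inv]
  obtain r :: nat where r: "\<And>v. v \<in> carrier_vec n \<Longrightarrow>
      (1\<^sub>m n *\<^sub>v v) \<bullet> (1\<^sub>m n *\<^sub>v v) \<le> of_nat r * ((A *\<^sub>v v) \<bullet> (A *\<^sub>v v))"
    using dom mat_succeq_iff_norm[OF one_carrier_mat A n n] by blast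
  have "(inv_mat A *\<^sub>v w) \<bullet> (inv_mat A *\<^sub>v w) \<le> of_nat r * (w \<bullet> w)" if w: "w \<in> carrier_vec n" for w
    using r[of "inv_mat A *\<^sub>v w"] I(1) w assoc_mult_mat_vec[OF A I(1) w] unfolding I(2) by simp
  then have "bounded_mat (inv_mat A)" unfolding bounded_mat_iff_norm[OF I(1) n n] by blast
  with inv bA show "invertible_mat A \<and> bounded_mat A \<and> bounded_mat (inv_mat A)" by blast
next
  assume inv: "invertible_mat A \<and> bounded_mat A \<and> bounded_mat (inv_mat A)"
  note I = inv_mat_inverts[OF A conjunct1[OF inv]]
  have "mat_succeq n (1\<^sub>m n) A"
    using mat_succeq_mult_left[OF I(1) A n n] I(3) inv by simp
  with inv show "bibounded_mat A" unfolding bibounded_mat_iff[OF A] by blast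
qed

theorem proposition5p5:
  fixes A :: "'a::linordered_field mat" and m n :: nat
  assumes "m \<ge> 1" and "n \<ge> 1" and "A \<in> carrier_mat m n"
  shows "(bounded_mat A \<longleftrightarrow> (\<forall>i<m. \<forall>j<n. bounded_scalar (A $$ (i, j))))
    \<and> (bibounded_mat A \<longleftrightarrow>
           bounded_mat A \<and> m \<ge> n \<and> (\<exists>d\<in>minors n A. bibounded_scalar d))
    \<and> (square_mat A \<longrightarrow>
           (bibounded_mat A \<longleftrightarrow>
              invertible_mat A \<and> bounded_mat A \<and> bounded_mat (inv_mat A)))"
proof (intro conjI impI)
  note mn = assms(1,2) and A = assms(3)
  show "bounded_mat A \<longleftrightarrow> (\<forall>i<m. \<forall>j<n. bounded_scalar (A $$ (i, j)))"
    by (rule bounded_mat_iff_entries[OF A mn])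
  show "bibounded_mat A \<longleftrightarrow> bounded_mat A \<and> m \<ge> n \<and> (\<exists>d\<in>minors n A. bibounded_scalar d)"
    using bibounded_minor_if_bibounded_mat[OF A mn] bibounded_mat_if_bibounded_minor[OF A mn]
      bibounded_mat_iff[OF A] by blast
  assume "square_mat A"
  then have "A \<in> carrier_mat n n" using A by auto
  then show "bibounded_mat A \<longleftrightarrow> invertible_mat A \<and> bounded_mat A \<and> bounded_mat (inv_mat A)"
    using mn(2) by (rule bibounded_square_mat_iff)
qed

end
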